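(* Let $S\subseteq\mathbb{H}$ be open and let $f:S\to\mathbb{H}$ be continuous, such that its right HR derivatives exist and are continuous in $S$. If $q_0,q_1\in S$ are such that the segment joining them is also in $S$, then, with $\lambda=q_1-q_0$, $$f(q_1)-f(q_0)=\int_0^1\left(\lambda\frac{\partial_r f(q_0+t\lambda)}{\partial q}+\lambda^i\frac{\partial_r f(q_0+t\lambda)}{\partial q^i}+\lambda^j\frac{\partial_r f(q_0+t\lambda)}{\partial q^j}+\lambda^k\frac{\partial_r f(q_0+t\lambda)}{\partial q^k}\right)dt$$ $$=\int_0^1\left(\lambda^*\frac{\partial_r f(q_0+t\lambda)}{\partial q^*}+\lambda^{i*}\frac{\partial_r f(q_0+t\lambda)}{\partial q^{i*}}+\lambda^{j*}\frac{\partial_r f(q_0+t\lambda)}{\partial q^{j*}}+\lambda^{k*}\frac{\partial_r f(q_0+t\lambda)}{\partial q^{k*}}\right)dt .$$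
   Context: $\mathbb{H}$ denotes the real quaternions $q=q_a+iq_b+jq_c+kq_d$ with $q_a,q_b,q_c,q_d\in\mathbb{R}$ and $i^2=j^2=k^2=ijk=-1$. The conjugate is $q^*=q_a-iq_b-jq_c-kq_d$. For $\mu\in\{1,i,j,k\}$ and $p\in\mathbb{H}$, $p^{\mu}:=\mu p\mu^{-1}$ and $p^{\mu*}:=(p^{\mu})^*$. An $\mathbb{H}$-valued function $f$ is regarded as a function of the four real variables $q_a,q_b,q_c,q_d$, with ($\mathbb{H}$-valued, componentwise) partial derivatives $\frac{\partial f}{\partial q_a},\dots,\frac{\partial f}{\partial q_d}$. The right HR derivatives of $f$ are, for $\mu\in\{1,i,j,k\}$, $$\frac{\partial_r f}{\partial q^{\mu}}=\frac14\left(\frac{\partial f}{\partial q_a}-i^{\mu}\frac{\partial f}{\partial q_b}-j^{\mu}\frac{\partial f}{\partial q_c}-k^{\mu}\frac{\partial f}{\partial q_d}\right),\qquad \frac{\partial_r f}{\partial q^{\mu*}}=\frac14\left(\frac{\partial f}{\partial q_a}+i^{\mu}\frac{\partial f}{\partial q_b}+j^{\mu}\frac{\partial f}{\partial q_c}+k^{\mu}\frac{\partial f}{\partial q_d}\right),$$ where for $\mu=1$ one writes $\frac{\partial_r f}{\partial q}$ and $\frac{\partial_r f}{\partial q^*}$. $\frac{\partial_r f(q_0+t\lambda)}{\partial q^{\mu}}$ denotes this derivative evaluated at the point $q_0+t\lambda$. Integrals of $\mathbb{H}$-valued functions are taken componentwise. *)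

theory Defs
  imports "HOL-Analysis.Analysis"
begin

codatatype quat = Quat (part_a: real) (part_b: real) (part_c: real) (part_d: real)

lemma quat_eqI [intro?]:
  "part_a x = part_a y \<Longrightarrow> part_b x = part_b y \<Longrightarrow> part_c x = part_c y \<Longrightarrow> part_d x = part_d y \<Longrightarrow> x = y"
  by (rule quat.expand) simp

lemma quat_eq_iff:
  "x = y \<longleftrightarrow> part_a x = part_a y \<and> part_b x = part_b y \<and> part_c x = part_c y \<and> part_d x = part_d y"
  by (auto intro: quat_eqI)

instantiation quat :: ab_group_add
begin

primcorec zero_quat where
  "part_a 0 = 0" | "part_b 0 = 0" | "part_c 0 = 0" | "part_d 0 = 0"

primcorec plus_quat where
  "part_a (x + y) = part_a x + part_a y"
| "part_b (x + y) = part_b x + part_b y"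
| "part_c (x + y) = part_c x + part_c y"
| "part_d (x + y) = part_d x + part_d y"

primcorec uminus_quat where
  "part_a (- x) = - part_a x"
| "part_b (- x) = - part_b x"
| "part_c (- x) = - part_c x"
| "part_d (- x) = - part_d x"

primcorec minus_quat where
  "part_a (x - y) = part_a x - part_a y"
| "part_b (x - y) = part_b x - part_b y"
| "part_c (x - y) = part_c x - part_c y"
| "part_d (x - y) = part_d x - part_d y"

instance
  by standard (simp_all add: quat_eq_iff)

end

primcorec quat_cnj :: "quat \<Rightarrow> quat" where
  "part_a (quat_cnj x) = part_a x"
| "part_b (quat_cnj x) = - part_b x"
| "part_c (quat_cnj x) = - part_c x"
| "part_d (quat_cnj x) = - part_d x"

instantiation quat :: real_vector
begin

primcorec scaleR_quat where
  "part_a (scaleR r x) = r * part_a x"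
| "part_b (scaleR r x) = r * part_b x"
| "part_c (scaleR r x) = r * part_c x"
| "part_d (scaleR r x) = r * part_d x"

instance
  by standard (simp_all add: quat_eq_iff algebra_simps)

end

instantiation quat :: real_inner
begin

definition inner_quat :: "quat \<Rightarrow> quat \<Rightarrow> real" where
  "inner_quat x y =
     part_a x * part_a y + part_b x * part_b y + part_c x * part_c y + part_d x * part_d y"

definition norm_quat :: "quat \<Rightarrow> real" where
  "norm_quat x = sqrt (inner x x)"

definition sgn_quat :: "quat \<Rightarrow> quat" where
  "sgn_quat x = x /\<^sub>R norm x"

definition dist_quat :: "quat \<Rightarrow> quat \<Rightarrow> real" where
  "dist_quat x y = norm (x - y)"

definition uniformity_quat :: "(quat \<times> quat) filter" where
  "uniformity_quat = (INF e\<in>{0 <..}. principal {(x, y). dist x y < e})"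

definition open_quat :: "quat set \<Rightarrow> bool" where
  "open_quat U \<longleftrightarrow> (\<forall>x\<in>U. eventually (\<lambda>(x', y). x' = x \<longrightarrow> y \<in> U) uniformity)"

instance
proof
  fix x y z :: quat and r :: real
  show "0 \<le> inner x x"
    by (simp add: inner_quat_def)
  show "inner x x = 0 \<longleftrightarrow> x = 0"
  proof
    assume "inner x x = 0"
    then have "(part_a x)\<^sup>2 + (part_b x)\<^sup>2 + (part_c x)\<^sup>2 + (part_d x)\<^sup>2 = 0"
      by (simp add: inner_quat_def power2_eq_square)
    then show "x = 0"
      by (simp add: quat_eq_iff add_nonneg_eq_0_iff)
  qed (simp add: inner_quat_def)
qed (simp_all add: inner_quat_def norm_quat_def sgn_quat_def dist_quat_def uniformity_quat_def
      open_quat_def algebra_simps)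

end

instantiation quat :: real_normed_div_algebra
begin

primcorec one_quat where
  "part_a 1 = 1" | "part_b 1 = 0" | "part_c 1 = 0" | "part_d 1 = 0"

primcorec times_quat where
  "part_a (x * y) = part_a x * part_a y - part_b x * part_b y - part_c x * part_c y - part_d x * part_d y"
| "part_b (x * y) = part_a x * part_b y + part_b x * part_a y + part_c x * part_d y - part_d x * part_c y"
| "part_c (x * y) = part_a x * part_c y - part_b x * part_d y + part_c x * part_a y + part_d x * part_b y"
| "part_d (x * y) = part_a x * part_d y + part_b x * part_c y - part_c x * part_b y + part_d x * part_a y"

definition inverse_quat :: "quat \<Rightarrow> quat" where
  "inverse x = quat_cnj x /\<^sub>R (norm x)\<^sup>2"

definition divide_quat :: "quat \<Rightarrow> quat \<Rightarrow> quat" where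
  "divide_quat x y = x * inverse y"

instance
proof
  fix x y :: quat
  have n2: "(norm z)\<^sup>2 = part_a z * part_a z + part_b z * part_b z + part_c z * part_c z + part_d z * part_d z"
    for z :: quat
    by (simp add: power2_norm_eq_inner inner_quat_def)
  have cnj: "quat_cnj z * z = (norm z)\<^sup>2 *\<^sub>R 1" "z * quat_cnj z = (norm z)\<^sup>2 *\<^sub>R 1" for z :: quat
    by (simp_all add: quat_eq_iff n2)
  have sl: "(r *\<^sub>R u) * v = r *\<^sub>R (u * v)" "u * (r *\<^sub>R v) = r *\<^sub>R (u * v)" for r :: real and u v :: quat
    by (simp_all add: quat_eq_iff algebra_simps)
  show "x \<noteq> 0 \<Longrightarrow> inverse x * x = 1" "x \<noteq> 0 \<Longrightarrow> x * inverse x = 1"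
    by (simp_all add: inverse_quat_def sl cnj)
  show "norm (x * y) = norm x * norm y"
  proof (rule power2_eq_imp_eq)
    show "(norm (x * y))\<^sup>2 = (norm x * norm y)\<^sup>2"
      unfolding power_mult_distrib n2 times_quat.simps by algebra
  qed simp_all
qed (simp_all add: quat_eq_iff inverse_quat_def divide_quat_def algebra_simps)

end

definition quat_i :: quat where "quat_i = Quat 0 1 0 0"
definition quat_j :: quat where "quat_j = Quat 0 0 1 0"
definition quat_k :: quat where "quat_k = Quat 0 0 0 1"

lemma quat_units_sel [simp]:
  "part_a quat_i = 0" "part_b quat_i = 1" "part_c quat_i = 0" "part_d quat_i = 0"
  "part_a quat_j = 0" "part_b quat_j = 0" "part_c quat_j = 1" "part_d quat_j = 0"
  "part_a quat_k = 0" "part_b quat_k = 0" "part_c quat_k = 0" "part_d quat_k = 1"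
  by (simp_all add: quat_i_def quat_j_def quat_k_def)

lemma quat_units_mult:
  "quat_i * quat_i = -1" "quat_j * quat_j = -1" "quat_k * quat_k = -1"
  "quat_i * quat_j * quat_k = -1"
  by (simp_all add: quat_eq_iff)

lemma quat_decompose:
  "q = part_a q *\<^sub>R 1 + part_b q *\<^sub>R quat_i + part_c q *\<^sub>R quat_j + part_d q *\<^sub>R quat_k"
  by (simp add: quat_eq_iff)

text \<open>
  With this instance, vector-valued integrals (and derivatives) of quaternion-valued functions
  are the componentwise ones with respect to \<open>1, i, j, k\<close>.
\<close>

instantiation quat :: euclidean_space
begin

definition Basis_quat :: "quat set" where
  "Basis_quat = {1, quat_i, quat_j, quat_k}"

instance
proof
  show "(Basis :: quat set) \<noteq> {}" "finite (Basis :: quat set)"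
    by (simp_all add: Basis_quat_def)
  show "inner u v = (if u = v then 1 else 0)" if "u \<in> Basis" "v \<in> Basis" for u v :: quat
    using that by (auto simp: Basis_quat_def inner_quat_def quat_eq_iff)
  show "(\<forall>u\<in>Basis. inner x u = 0) \<longleftrightarrow> x = 0" for x :: quat
    by (simp add: Basis_quat_def inner_quat_def quat_eq_iff [of x 0])
qed

end

text \<open>The rotation $p^\mu$; it is used only for \<open>\<mu> \<in> {1, i, j, k}\<close>.\<close>

definition quat_rot :: "quat \<Rightarrow> quat \<Rightarrow> quat" where
  "quat_rot p \<mu> = \<mu> * p * inverse \<mu>"

definition quat_units :: "quat set" where
  "quat_units = {1, quat_i, quat_j, quat_k}"

text \<open>
  The partial derivative with respect to the real coordinate belonging to the basis
  quaternion \<open>e\<close>: \<open>e = 1\<close> gives $q_a$, \<open>e = i\<close> gives $q_b$, and so on.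
\<close>

definition quat_partial_exists :: "(quat \<Rightarrow> quat) \<Rightarrow> quat \<Rightarrow> quat \<Rightarrow> bool" where
  "quat_partial_exists f e q \<longleftrightarrow> (\<lambda>t::real. f (q + t *\<^sub>R e)) differentiable (at 0)"

definition quat_partial :: "(quat \<Rightarrow> quat) \<Rightarrow> quat \<Rightarrow> quat \<Rightarrow> quat" where
  "quat_partial f e q = vector_derivative (\<lambda>t::real. f (q + t *\<^sub>R e)) (at 0)"

text \<open>
  Every right HR derivative is a combination of all four partial derivatives, so the right HR
  derivatives exist at a point precisely when the four partial derivatives exist there.  This does
  not require \<open>f\<close> to be (Frechet) differentiable.
\<close>

definition right_HR_derivs_exist :: "(quat \<Rightarrow> quat) \<Rightarrow> quat \<Rightarrow> bool" where
  "right_HR_derivs_exist f q \<longleftrightarrow> (\<forall>e\<in>quat_units. quat_partial_exists f e q)"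

text \<open>
  As in the right HR calculus, the imaginary units multiply the partial derivatives from the left.
\<close>

definition right_HR_deriv :: "(quat \<Rightarrow> quat) \<Rightarrow> quat \<Rightarrow> quat \<Rightarrow> quat" where
  "right_HR_deriv f \<mu> q = (1/4) *\<^sub>R
     (quat_partial f 1 q
      - quat_rot quat_i \<mu> * quat_partial f quat_i q
      - quat_rot quat_j \<mu> * quat_partial f quat_j q
      - quat_rot quat_k \<mu> * quat_partial f quat_k q)"

definition right_HR_deriv_cnj :: "(quat \<Rightarrow> quat) \<Rightarrow> quat \<Rightarrow> quat \<Rightarrow> quat" where
  "right_HR_deriv_cnj f \<mu> q = (1/4) *\<^sub>R
     (quat_partial f 1 q
      + quat_rot quat_i \<mu> * quat_partial f quat_i q
      + quat_rot quat_j \<mu> * quat_partial f quat_j q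
      + quat_rot quat_k \<mu> * quat_partial f quat_k q)"

end

theory Submission
  imports Defs
begin

text \<open>
  Both integrands equal the total derivative of \<open>f\<close> applied to \<open>lam\<close>, so the theorem is the
  fundamental theorem of calculus for \<open>f\<close> restricted to the segment.  Two facts make this work.

  The first is algebraic.  The maps \<open>p \<mapsto> p\<^sup>\<mu>\<close> for \<open>\<mu> \<in> {1, i, j, k}\<close> are algebra automorphisms, and
  they form a group: each nontrivial one is a half turn about an imaginary axis, and it flips the sign
  of the other two imaginary coordinates.  Averaging over them therefore
  leaves the real part, \<open>\<Sum>\<mu>. p\<^sup>\<mu> = 4 Re p\<close>.  Expanding \<open>\<Sum>\<mu>. lam\<^sup>\<mu> (\<partial>\<^sub>r f / \<partial>q\<^sup>\<mu>)\<close> along the four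
  partial derivatives, the derivative in direction \<open>e = i, j, k\<close> gets the coefficient
  \<open>- Re (lam e)\<close>, and the one in direction \<open>1\<close> gets \<open>Re lam\<close>; these are exactly the real coordinates of
  \<open>lam\<close> (\<open>right_HR_chain\<close>).  Conjugation commutes with the
  rotations and flips the imaginary coordinates of \<open>lam\<close>, which compensates the opposite signs in the
  conjugate derivatives, so the second sum comes out the same (\<open>right_HR_cnj_chain\<close>).

  The second is analytic.  Among the derivatives of \<open>f\<close>, only the right HR ones are assumed continuous,
  whereas the chain rule along a slanted segment needs \<open>f\<close> to be Frechet differentiable.  The algebraic identity,
  read with a basis quaternion \<open>e\<close> in place of \<open>lam\<close>, recovers the partial derivative along \<open>e\<close> as a
  combination of right HR derivatives with constant coefficients.  Hence the
  partial derivatives are continuous (\<open>continuous_on_quat_partial\<close>), and a function with continuous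
  partial derivatives on an open set is Frechet differentiable
  (\<open>has_derivative_of_continuous_partials\<close>).
\<close>

section \<open>Differentiability from continuous partial derivatives\<close>

text \<open>
  The mean value inequality on the line through \<open>y\<close> in direction \<open>b\<close>, applied to \<open>f\<close> minus the linear
  function with slope \<open>v\<close>.  The slope is free so that it can be the derivative at a
  point that does not lie on that line.
\<close>

lemma directional_increment_bound:
  fixes f :: "'a::real_normed_vector \<Rightarrow> 'b::real_normed_vector"
  assumes deriv: "\<And>t. \<bar>t\<bar> \<le> \<bar>c\<bar> \<Longrightarrow>
      ((\<lambda>s. f ((y + t *\<^sub>R b) + s *\<^sub>R b)) has_vector_derivative g (y + t *\<^sub>R b)) (at 0)"
    and bound: "\<And>t. \<bar>t\<bar> \<le> \<bar>c\<bar> \<Longrightarrow> norm (g (y + t *\<^sub>R b) - v) \<le> e"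
  shows "norm (f (y + c *\<^sub>R b) - f y - c *\<^sub>R v) \<le> e * \<bar>c\<bar>"
proof -
  define h where "h t = f (y + t *\<^sub>R b) - t *\<^sub>R v" for t
  have "norm (h c - h 0) \<le> e * norm (c - 0)"
  proof (rule differentiable_bound)
    show "convex (closed_segment 0 c)" by simp
    fix t assume "t \<in> closed_segment 0 c"
    then have t: "\<bar>t\<bar> \<le> \<bar>c\<bar>"
      by (auto simp: closed_segment_eq_real_ivl split: if_splits)
    \<comment> \<open>Translating the parameter moves the derivative from \<open>0\<close> to \<open>t\<close>.\<close>
    have "((\<lambda>s. f (y + s *\<^sub>R b)) has_vector_derivative g (y + t *\<^sub>R b)) (at t)"
    proof -
      have "((\<lambda>s. f ((y + t *\<^sub>R b) + s *\<^sub>R b)) \<circ> (\<lambda>s. s - t)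
          has_vector_derivative 1 *\<^sub>R g (y + t *\<^sub>R b)) (at t)"
        by (rule vector_diff_chain_at) (use deriv[OF t] in \<open>auto intro!: derivative_eq_intros\<close>)
      then show ?thesis by (simp add: o_def algebra_simps)
    qed
    then have "(h has_vector_derivative g (y + t *\<^sub>R b) - v) (at t)"
      unfolding h_def by (auto intro!: derivative_eq_intros)
    then show "(h has_derivative (\<lambda>s. s *\<^sub>R (g (y + t *\<^sub>R b) - v))) (at t within closed_segment 0 c)"
      using has_derivative_at_withinI has_vector_derivative_def by blast
    show "onorm (\<lambda>s. s *\<^sub>R (g (y + t *\<^sub>R b) - v)) \<le> e"
      by (rule onorm_le) (use bound[OF t] in \<open>simp add: mult.commute[of e] mult_left_mono\<close>)
  qed auto
  then show ?thesis by (simp add: h_def algebra_simps)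
qed

text \<open>
  The directions are handled one at a time: move first by \<open>c b\<close> along \<open>b\<close>, where continuity of
  \<open>g b\<close> keeps the slope within \<open>e\<close> of \<open>g b x\<close>, and then along the remaining directions.  The second move
  starts at a displaced point, so the induction needs the estimate uniformly for all base points \<open>y\<close>
  near \<open>x\<close>, not just at \<open>x\<close>.
\<close>

lemma increment_estimate_of_continuous_directional_derivatives:
  fixes f :: "'a::real_normed_vector \<Rightarrow> 'b::real_normed_vector"
  assumes "finite B" and "open S" and x: "x \<in> S"
    and deriv: "\<And>b y. b \<in> B \<Longrightarrow> y \<in> S \<Longrightarrow>
      ((\<lambda>t. f (y + t *\<^sub>R b)) has_vector_derivative g b y) (at 0)"
    and cont: "\<And>b. b \<in> B \<Longrightarrow> continuous_on S (g b)"
    and e: "0 < e"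
  shows "\<exists>d>0. \<forall>y c. dist y x < d \<longrightarrow> (\<forall>b\<in>B. \<bar>c b\<bar> < d) \<longrightarrow>
    norm (f (y + (\<Sum>b\<in>B. c b *\<^sub>R b)) - f y - (\<Sum>b\<in>B. c b *\<^sub>R g b x)) \<le> e * (\<Sum>b\<in>B. \<bar>c b\<bar>)"
  using \<open>finite B\<close> deriv cont
proof (induction B)
  case empty
  show ?case by (auto intro: exI[of _ 1])
next
  case (insert b B)
  obtain d1 where d1: "d1 > 0" "\<forall>y c. dist y x < d1 \<longrightarrow> (\<forall>b\<in>B. \<bar>c b\<bar> < d1) \<longrightarrow>
      norm (f (y + (\<Sum>b\<in>B. c b *\<^sub>R b)) - f y - (\<Sum>b\<in>B. c b *\<^sub>R g b x)) \<le> e * (\<Sum>b\<in>B. \<bar>c b\<bar>)"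
    using insert.IH[OF insert.prems(1)[OF insertI2] insert.prems(2)[OF insertI2]] by blast
  obtain d2 where d2: "d2 > 0" "ball x d2 \<subseteq> S"
    using \<open>open S\<close> x open_contains_ball by blast
  have "continuous_on S (g b)" using insert.prems by blast
  then obtain d3 where d3: "d3 > 0" "\<And>y. y \<in> S \<Longrightarrow> dist y x < d3 \<Longrightarrow> dist (g b y) (g b x) \<le> e"
    using x e unfolding continuous_on_iff by (meson less_imp_le)
  \<comment> \<open>A move of length at most \<open>d\<close> in the parameter displaces a point by at most \<open>d * norm b\<close>, so this
      \<open>d\<close> keeps every point of the first move within \<open>m\<close> of \<open>x\<close>.\<close>
  define m where "m = min d1 (min d2 d3)"
  define d where "d = m / (1 + norm b)"
  have m: "m > 0" using d1 d2 d3 by (simp add: m_def)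
  have d: "0 < d" "d + d * norm b = m" "d \<le> m"
  proof -
    have n: "1 + norm b > 0" by (simp add: add_pos_nonneg)
    show "0 < d" using m n by (simp add: d_def)
    moreover have "d * (1 + norm b) = m" using n by (simp add: d_def)
    ultimately show "d + d * norm b = m" by (simp add: distrib_left)
    then show "d \<le> m" using mult_nonneg_nonneg[OF less_imp_le[OF \<open>0 < d\<close>] norm_ge_zero[of b]] by linarith
  qed
  show ?case
  proof (intro exI[of _ d] conjI allI impI)
    fix y c assume y: "dist y x < d" and c: "\<forall>i\<in>insert b B. \<bar>c i\<bar> < d"
    have near: "dist (y + t *\<^sub>R b) x < m" if "\<bar>t\<bar> \<le> \<bar>c b\<bar>" for t
    proof -
      have "dist (y + t *\<^sub>R b) x \<le> dist y x + \<bar>t\<bar> * norm b"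
        using norm_triangle_ineq[of "y - x" "t *\<^sub>R b"] by (simp add: dist_norm algebra_simps)
      also have "\<bar>t\<bar> * norm b \<le> d * norm b"
        using that c by (intro mult_right_mono) auto
      finally show ?thesis using y d by linarith
    qed
    have inS: "y + t *\<^sub>R b \<in> S" if "\<bar>t\<bar> \<le> \<bar>c b\<bar>" for t
      using near[OF that] d2 by (auto simp: m_def dist_commute)
    have 1: "norm (f (y + c b *\<^sub>R b) - f y - c b *\<^sub>R g b x) \<le> e * \<bar>c b\<bar>"
    proof (rule directional_increment_bound[where g = "g b"])
      fix t assume t: "\<bar>t\<bar> \<le> \<bar>c b\<bar>"
      show "((\<lambda>s. f (y + t *\<^sub>R b + s *\<^sub>R b)) has_vector_derivative g b (y + t *\<^sub>R b)) (at 0)"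
        using insert.prems(1)[OF _ inS[OF t]] by blast
      show "norm (g b (y + t *\<^sub>R b) - g b x) \<le> e"
        using d3(2)[OF inS[OF t]] near[OF t] by (simp add: dist_norm m_def)
    qed
    have 2: "norm (f (y + c b *\<^sub>R b + (\<Sum>b\<in>B. c b *\<^sub>R b)) - f (y + c b *\<^sub>R b)
        - (\<Sum>b\<in>B. c b *\<^sub>R g b x)) \<le> e * (\<Sum>b\<in>B. \<bar>c b\<bar>)"
      using c d near[of "c b"] by (intro d1(2)[rule_format]) (auto simp: m_def)
    show "norm (f (y + (\<Sum>i\<in>insert b B. c i *\<^sub>R i)) - f y - (\<Sum>i\<in>insert b B. c i *\<^sub>R g i x))
        \<le> e * (\<Sum>i\<in>insert b B. \<bar>c i\<bar>)"
      using insert.hyps norm_triangle_mono[OF 1 2] by (simp add: algebra_simps)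
  qed (use d in auto)
qed

lemma has_derivative_of_continuous_partials:
  fixes f :: "'a::euclidean_space \<Rightarrow> 'b::real_normed_vector"
  assumes "open S" and "x \<in> S"
    and "\<And>b y. b \<in> Basis \<Longrightarrow> y \<in> S \<Longrightarrow>
      ((\<lambda>t. f (y + t *\<^sub>R b)) has_vector_derivative g b y) (at 0)"
    and "\<And>b. b \<in> Basis \<Longrightarrow> continuous_on S (g b)"
  shows "(f has_derivative (\<lambda>h. \<Sum>b\<in>Basis. (h \<bullet> b) *\<^sub>R g b x)) (at x)"
  unfolding has_derivative_at_alt
proof (intro conjI allI impI)
  show "bounded_linear (\<lambda>h. \<Sum>b\<in>Basis. (h \<bullet> b) *\<^sub>R g b x)"
    by (intro bounded_linear_sum bounded_linear_scaleR_const bounded_linear_inner_left)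
  fix e :: real assume e: "0 < e"
  define e' where "e' = e / DIM('a)"
  have e': "0 < e'" "e' * DIM('a) = e" using e by (simp_all add: e'_def)
  obtain d where d: "d > 0" "\<forall>y c. dist y x < d \<longrightarrow> (\<forall>b\<in>Basis. \<bar>c b\<bar> < d) \<longrightarrow>
      norm (f (y + (\<Sum>b\<in>Basis. c b *\<^sub>R b)) - f y - (\<Sum>b\<in>Basis. c b *\<^sub>R g b x))
        \<le> e' * (\<Sum>b\<in>Basis. \<bar>c b\<bar>)"
    using increment_estimate_of_continuous_directional_derivatives
      [OF finite_Basis assms(1-4) e'(1)] by blast
  show "\<exists>d>0. \<forall>y. norm (y - x) < d \<longrightarrow>
      norm (f y - f x - (\<Sum>b\<in>Basis. ((y - x) \<bullet> b) *\<^sub>R g b x)) \<le> e * norm (y - x)"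
  proof (intro exI[of _ d] conjI allI impI)
    fix y assume y: "norm (y - x) < d"
    have comp: "\<bar>(y - x) \<bullet> b\<bar> \<le> norm (y - x)" if "b \<in> Basis" for b
      using Basis_le_norm that by blast
    have "norm (f y - f x - (\<Sum>b\<in>Basis. ((y - x) \<bullet> b) *\<^sub>R g b x))
        \<le> e' * (\<Sum>b\<in>Basis. \<bar>(y - x) \<bullet> b\<bar>)"
      using d(2)[rule_format, of x "\<lambda>b. (y - x) \<bullet> b"] d(1) le_less_trans[OF comp y]
      by (simp add: euclidean_representation)
    also have "\<dots> \<le> e' * (DIM('a) * norm (y - x))"
      using e' comp sum_bounded_above[of Basis "\<lambda>b. \<bar>(y - x) \<bullet> b\<bar>" "norm (y - x)"]
      by (intro mult_left_mono) auto
    finally show "norm (f y - f x - (\<Sum>b\<in>Basis. ((y - x) \<bullet> b) *\<^sub>R g b x)) \<le> e * norm (y - x)"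
      using e'(2) by (simp flip: mult.assoc)
  qed (fact d(1))
qed

section \<open>Sums over the four rotated frames\<close>

lemma quat_rot_mult:
  assumes "\<mu> \<noteq> 0"
  shows "quat_rot p \<mu> * quat_rot q \<mu> = quat_rot (p * q) \<mu>"
proof -
  have "quat_rot p \<mu> * quat_rot q \<mu> = \<mu> * p * (inverse \<mu> * \<mu>) * q * inverse \<mu>"
    by (simp only: quat_rot_def mult.assoc)
  then show ?thesis by (simp add: assms quat_rot_def mult.assoc)
qed

lemma quat_rot_unit:
  "quat_rot p 1 = p"
  "quat_rot p quat_i = Quat (part_a p) (part_b p) (- part_c p) (- part_d p)"
  "quat_rot p quat_j = Quat (part_a p) (- part_b p) (part_c p) (- part_d p)"
  "quat_rot p quat_k = Quat (part_a p) (- part_b p) (- part_c p) (part_d p)"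
  by (simp_all add: quat_rot_def inverse_quat_def norm_quat_def inner_quat_def quat_eq_iff)

lemma quat_units_nonzero: "quat_i \<noteq> 0" "quat_j \<noteq> 0" "quat_k \<noteq> 0"
  by (simp_all add: quat_eq_iff)

text \<open>
  Each imaginary coordinate keeps its sign under two of the four rotations and changes it under the
  other two, so only the real part survives.
\<close>

lemma sum_quat_rot:
  "p + quat_rot p quat_i + quat_rot p quat_j + quat_rot p quat_k = (4 * part_a p) *\<^sub>R 1"
  unfolding quat_rot_unit by (simp add: quat_eq_iff)

lemma quat_cnj_rot_unit:
  assumes "\<mu> \<in> quat_units"
  shows "quat_cnj (quat_rot p \<mu>) = quat_rot (quat_cnj p) \<mu>"
  using assms by (auto simp: quat_units_def quat_rot_unit intro!: quat_eqI)

lemma sum_quat_rot_mult: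
  "w * p + quat_rot w quat_i * quat_rot p quat_i + quat_rot w quat_j * quat_rot p quat_j
    + quat_rot w quat_k * quat_rot p quat_k = (4 * part_a (w * p)) *\<^sub>R 1"
  by (simp only: quat_rot_mult quat_units_nonzero not_False_eq_True sum_quat_rot)

text \<open>
  This evaluates the sums of both kinds of right HR derivatives at once; the signs in front of the
  units are absorbed into \<open>x1\<close>, \<open>x2\<close>, \<open>x3\<close>.  Since \<open>w\<^sup>\<mu> u\<^sup>\<mu> = (w u)\<^sup>\<mu>\<close>, the coefficient of \<open>x1\<close> is the
  rotation sum of \<open>w i\<close>, which is \<open>4 Re (w i) = - 4 w\<^sub>b\<close>, and likewise for \<open>j\<close> and \<open>k\<close>.
\<close>

lemma rotated_frame_average:
  fixes w x0 x1 x2 x3 :: quat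
  defines "D \<equiv> \<lambda>\<mu>. x0 + quat_rot quat_i \<mu> * x1 + quat_rot quat_j \<mu> * x2 + quat_rot quat_k \<mu> * x3"
  shows "w * D 1 + quat_rot w quat_i * D quat_i + quat_rot w quat_j * D quat_j
      + quat_rot w quat_k * D quat_k
    = 4 *\<^sub>R (part_a w *\<^sub>R x0 - part_b w *\<^sub>R x1 - part_c w *\<^sub>R x2 - part_d w *\<^sub>R x3)"
proof -
  have expand: "quat_rot w \<mu> * D \<mu> = quat_rot w \<mu> * x0
      + (quat_rot w \<mu> * quat_rot quat_i \<mu>) * x1
      + (quat_rot w \<mu> * quat_rot quat_j \<mu>) * x2
      + (quat_rot w \<mu> * quat_rot quat_k \<mu>) * x3" for \<mu>
    by (simp only: D_def distrib_left mult.assoc)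
  have "w * D 1 + quat_rot w quat_i * D quat_i + quat_rot w quat_j * D quat_j
      + quat_rot w quat_k * D quat_k
    = (w + quat_rot w quat_i + quat_rot w quat_j + quat_rot w quat_k) * x0
      + (w * quat_i + quat_rot w quat_i * quat_rot quat_i quat_i
        + quat_rot w quat_j * quat_rot quat_i quat_j + quat_rot w quat_k * quat_rot quat_i quat_k) * x1
      + (w * quat_j + quat_rot w quat_i * quat_rot quat_j quat_i
        + quat_rot w quat_j * quat_rot quat_j quat_j + quat_rot w quat_k * quat_rot quat_j quat_k) * x2
      + (w * quat_k + quat_rot w quat_i * quat_rot quat_k quat_i
        + quat_rot w quat_j * quat_rot quat_k quat_j + quat_rot w quat_k * quat_rot quat_k quat_k) * x3"
    unfolding expand[of 1, unfolded quat_rot_unit(1)] expand distrib_right by (simp only: ac_simps)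
  also have "\<dots> = 4 *\<^sub>R (part_a w *\<^sub>R x0 - part_b w *\<^sub>R x1 - part_c w *\<^sub>R x2 - part_d w *\<^sub>R x3)"
    unfolding sum_quat_rot sum_quat_rot_mult by (simp add: scaleR_diff_right)
  finally show ?thesis .
qed

lemma sum_quat_Basis:
  fixes F :: "quat \<Rightarrow> quat"
  shows "(\<Sum>e\<in>Basis. (h \<bullet> e) *\<^sub>R F e) =
    part_a h *\<^sub>R F 1 + part_b h *\<^sub>R F quat_i + part_c h *\<^sub>R F quat_j + part_d h *\<^sub>R F quat_k"
proof -
  have "distinct [1, quat_i, quat_j, quat_k]" by (simp add: quat_eq_iff)
  then show ?thesis by (simp add: Basis_quat_def inner_quat_def)
qed

lemma right_HR_chain:
  "lam * right_HR_deriv f 1 q + quat_rot lam quat_i * right_HR_deriv f quat_i q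
    + quat_rot lam quat_j * right_HR_deriv f quat_j q
    + quat_rot lam quat_k * right_HR_deriv f quat_k q
   = (\<Sum>e\<in>Basis. (lam \<bullet> e) *\<^sub>R quat_partial f e q)"
proof -
  have D: "right_HR_deriv f \<mu> q = (1/4) *\<^sub>R (quat_partial f 1 q
      + quat_rot quat_i \<mu> * (- quat_partial f quat_i q)
      + quat_rot quat_j \<mu> * (- quat_partial f quat_j q)
      + quat_rot quat_k \<mu> * (- quat_partial f quat_k q))" for \<mu>
    by (simp add: right_HR_deriv_def)
  show ?thesis
    unfolding D mult_scaleR_right scaleR_add_right[symmetric] rotated_frame_average sum_quat_Basis
    by simp
qed

lemma right_HR_cnj_chain:
  "quat_cnj lam * right_HR_deriv_cnj f 1 q
    + quat_cnj (quat_rot lam quat_i) * right_HR_deriv_cnj f quat_i q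
    + quat_cnj (quat_rot lam quat_j) * right_HR_deriv_cnj f quat_j q
    + quat_cnj (quat_rot lam quat_k) * right_HR_deriv_cnj f quat_k q
   = (\<Sum>e\<in>Basis. (lam \<bullet> e) *\<^sub>R quat_partial f e q)"
proof -
  have cnj: "quat_cnj (quat_rot lam quat_i) = quat_rot (quat_cnj lam) quat_i"
    "quat_cnj (quat_rot lam quat_j) = quat_rot (quat_cnj lam) quat_j"
    "quat_cnj (quat_rot lam quat_k) = quat_rot (quat_cnj lam) quat_k"
    by (rule quat_cnj_rot_unit, simp add: quat_units_def)+
  show ?thesis
    unfolding cnj right_HR_deriv_cnj_def mult_scaleR_right scaleR_add_right[symmetric]
      rotated_frame_average sum_quat_Basis
    by simp
qed

text \<open>
  The chain identity at the direction \<open>e\<close> itself collapses to the single partial derivative along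
  \<open>e\<close>, which inverts the definition of the right HR derivatives.
\<close>

lemma continuous_on_quat_partial:
  assumes "\<And>\<mu>. \<mu> \<in> quat_units \<Longrightarrow> continuous_on S (right_HR_deriv f \<mu>)"
    and "e \<in> Basis"
  shows "continuous_on S (quat_partial f e)"
proof -
  have partial: "quat_partial f e = (\<lambda>q. e * right_HR_deriv f 1 q
      + quat_rot e quat_i * right_HR_deriv f quat_i q
      + quat_rot e quat_j * right_HR_deriv f quat_j q
      + quat_rot e quat_k * right_HR_deriv f quat_k q)"
  proof
    fix q
    have "(\<Sum>b\<in>Basis. (e \<bullet> b) *\<^sub>R quat_partial f b q)
        = (\<Sum>b\<in>Basis. if e = b then quat_partial f b q else 0)"
      by (rule sum.cong[OF refl]) (simp add: inner_Basis assms(2))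
    also have "\<dots> = quat_partial f e q"
      by (simp only: sum.delta'[OF finite_Basis] assms(2) if_True)
    finally show "quat_partial f e q = e * right_HR_deriv f 1 q
        + quat_rot e quat_i * right_HR_deriv f quat_i q
        + quat_rot e quat_j * right_HR_deriv f quat_j q
        + quat_rot e quat_k * right_HR_deriv f quat_k q"
      unfolding right_HR_chain by (rule sym)
  qed
  show ?thesis
    unfolding partial
    by (intro continuous_on_add continuous_on_mult continuous_on_const assms(1))
      (simp_all add: quat_units_def)
qed

section \<open>Integration along a segment\<close>

theorem theorem3p17:
  fixes S :: "quat set" and f :: "quat \<Rightarrow> quat" and q0 q1 lam :: quat
  assumes "open S"
    and "continuous_on S f"
    and "\<And>q. q \<in> S \<Longrightarrow> right_HR_derivs_exist f q"
    and "\<And>\<mu>. \<mu> \<in> quat_units \<Longrightarrow> continuous_on S (right_HR_deriv f \<mu>)"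
    and "\<And>\<mu>. \<mu> \<in> quat_units \<Longrightarrow> continuous_on S (right_HR_deriv_cnj f \<mu>)"
    and "q0 \<in> S" and "q1 \<in> S"
    and "closed_segment q0 q1 \<subseteq> S"
    and "lam = q1 - q0"
  shows "((\<lambda>t::real.
            lam * right_HR_deriv f 1 (q0 + t *\<^sub>R lam)
          + quat_rot lam quat_i * right_HR_deriv f quat_i (q0 + t *\<^sub>R lam)
          + quat_rot lam quat_j * right_HR_deriv f quat_j (q0 + t *\<^sub>R lam)
          + quat_rot lam quat_k * right_HR_deriv f quat_k (q0 + t *\<^sub>R lam))
          has_integral (f q1 - f q0)) {0..1}
       \<and> ((\<lambda>t::real.
            quat_cnj lam * right_HR_deriv_cnj f 1 (q0 + t *\<^sub>R lam)
          + quat_cnj (quat_rot lam quat_i) * right_HR_deriv_cnj f quat_i (q0 + t *\<^sub>R lam)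
          + quat_cnj (quat_rot lam quat_j) * right_HR_deriv_cnj f quat_j (q0 + t *\<^sub>R lam)
          + quat_cnj (quat_rot lam quat_k) * right_HR_deriv_cnj f quat_k (q0 + t *\<^sub>R lam))
          has_integral (f q1 - f q0)) {0..1}"
proof -
  have total: "(f has_derivative (\<lambda>h. \<Sum>e\<in>Basis. (h \<bullet> e) *\<^sub>R quat_partial f e q)) (at q)"
    if "q \<in> S" for q
  proof (rule has_derivative_of_continuous_partials[OF \<open>open S\<close> that])
    fix e p :: quat assume "e \<in> Basis" "p \<in> S"
    then have "quat_partial_exists f e p"
      using assms(3) by (auto simp: right_HR_derivs_exist_def quat_units_def Basis_quat_def)
    then show "((\<lambda>t. f (p + t *\<^sub>R e)) has_vector_derivative quat_partial f e p) (at 0)"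
      unfolding quat_partial_exists_def quat_partial_def vector_derivative_works .
  qed (rule continuous_on_quat_partial[OF assms(4)])
  have "((\<lambda>t. \<Sum>e\<in>Basis. (lam \<bullet> e) *\<^sub>R quat_partial f e (q0 + t *\<^sub>R lam))
      has_integral f (q0 + 1 *\<^sub>R lam) - f (q0 + 0 *\<^sub>R lam)) {0..1}"
  proof (rule fundamental_theorem_of_calculus)
    fix t :: real assume "t \<in> {0..1}"
    then have "q0 + t *\<^sub>R lam \<in> S"
      using assms(8) unfolding assms(9) closed_segment_def
      by (force simp: algebra_simps)
    then have "(f has_derivative
        (\<lambda>h. \<Sum>e\<in>Basis. (h \<bullet> e) *\<^sub>R quat_partial f e (q0 + t *\<^sub>R lam))) (at (q0 + t *\<^sub>R lam))"
      by (rule total)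
    moreover have "((\<lambda>t. q0 + t *\<^sub>R lam) has_derivative (\<lambda>s. s *\<^sub>R lam)) (at t)"
      by (auto intro!: derivative_eq_intros)
    ultimately have "(f \<circ> (\<lambda>t. q0 + t *\<^sub>R lam) has_derivative
        (\<lambda>h. \<Sum>e\<in>Basis. (h \<bullet> e) *\<^sub>R quat_partial f e (q0 + t *\<^sub>R lam)) \<circ> (\<lambda>s. s *\<^sub>R lam)) (at t)"
      by (rule diff_chain_at[rotated])
    also have "(\<lambda>h. \<Sum>e\<in>Basis. (h \<bullet> e) *\<^sub>R quat_partial f e (q0 + t *\<^sub>R lam)) \<circ> (\<lambda>s. s *\<^sub>R lam)
        = (\<lambda>s. s *\<^sub>R (\<Sum>e\<in>Basis. (lam \<bullet> e) *\<^sub>R quat_partial f e (q0 + t *\<^sub>R lam)))"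
      by (simp only: o_def inner_scaleR_left scaleR_sum_right scaleR_scaleR)
    finally show "((\<lambda>t. f (q0 + t *\<^sub>R lam)) has_vector_derivative
        (\<Sum>e\<in>Basis. (lam \<bullet> e) *\<^sub>R quat_partial f e (q0 + t *\<^sub>R lam))) (at t within {0..1})"
      unfolding has_vector_derivative_def o_def by (rule has_derivative_at_withinI)
  qed simp
  moreover have "q0 + 1 *\<^sub>R lam = q1" "q0 + 0 *\<^sub>R lam = q0" by (simp_all add: assms(9))
  ultimately show ?thesis
    unfolding right_HR_chain right_HR_cnj_chain by (simp only: simp_thms)
qed

end
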